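(* If $(\mathcal O,\mathcal C,\mathbf 2_{\mathcal C},\iota)$ is an SFC-category, then the induced adjunction $\mathsf{pt}_{\mathcal C}\dashv\Omega_{\mathcal C}$ between $\mathcal C$ and $\mathbf{Top}_{\mathcal C}^{\mathrm{op}}$ is idempotent.
   Context: $\mathbf{Frm}$ is the category of frames and frame homomorphisms, $\mathbf 2=\{0<1\}$, $\mathbf{Top}$ the category of topological spaces, $\mathbb S$ the Sierpinski space ($\{0,1\}$ with opens $\emptyset,\{1\},\{0,1\}$); $|\cdot|$ denotes underlying sets and functions. Lifts. Let $U:\mathcal A\to\mathcal B$ be a faithful functor. A morphism $f:U(A)\to U(A')$ lifts if $f=U(p)$ for a (unique) $p$, its lift. A cartesian lift w.r.t. $U$ of a family $\{f_i:X\to U(C)\}$ is a pair $(\overline X,\theta)$, $\overline X\in\mathcal A$, $\theta:U(\overline X)\to X$ an isomorphism, such that for every $D$ a morphism $h:U(D)\to U(\overline X)$ lifts iff every $f_i\theta h$ lifts. A PFC-category is a quadruple $(\mathcal O,\mathcal C,\mathbf 2_{\mathcal C},\iota)$ with $\mathcal O:\mathcal C\to\mathbf{Frm}$ faithful, $\mathbf 2_{\mathcal C}\in\mathcal C$, $\iota:\mathcal O(\mathbf 2_{\mathcal C})\to\mathbf 2$ an isomorphism. $\mathbf{Top}_{\mathcal C}$ is the full subcategory of $\mathbf{Top}$ of spaces $X$ for which the family $\{|\iota^{-1}|\circ\chi_x:\mathbf{Top}(X,\mathbb S)\to|\mathcal O(\mathbf 2_{\mathcal C})|\mid x\in X\}$,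 $\chi_x(g)=g(x)$, has a cartesian lift $(\Omega_{\mathcal C}X,\theta_X)$ w.r.t. $|\mathcal O(-)|:\mathcal C\to\mathbf{Set}$; $\overline{\chi_x}:\Omega_{\mathcal C}X\to\mathbf 2_{\mathcal C}$ is the lift of $|\iota^{-1}|\circ\chi_x\circ\theta_X$. $\mathsf{pt}_{\mathcal C}(C)$ is the set $\mathcal C(C,\mathbf 2_{\mathcal C})$ with opens $\{f\mid\iota(\mathcal Of(a))=1\}$, $a\in\mathcal O(C)$. It is an SFC-category if $\mathbb S\in\mathbf{Top}_{\mathcal C}$ and $\mathsf{pt}_{\mathcal C}(C)\in\mathbf{Top}_{\mathcal C}$ for all $C$. Then there is an adjunction $\mathsf{pt}_{\mathcal C}\dashv\Omega_{\mathcal C}$, where $\mathsf{pt}_{\mathcal C}:\mathcal C\to\mathbf{Top}_{\mathcal C}^{\mathrm{op}}$ acts by precomposition, $\Omega_{\mathcal C}:\mathbf{Top}_{\mathcal C}^{\mathrm{op}}\to\mathcal C$ sends $f:X\to Y$ to the lift of $\theta_X^{-1}\circ(-\circ f)\circ\theta_Y$, with units $\sigma^{\mathcal C}_X:X\to\mathsf{pt}_{\mathcal C}\Omega_{\mathcal C}X$, $x\mapsto\overline{\chi_x}$, and $\eta^{\mathcal C}_C:C\to\Omega_{\mathcal C}\mathsf{pt}_{\mathcal C}C$ determined by $\theta_{\mathsf{pt}_{\mathcal C}C}\circ|\mathcal O\eta^{\mathcal C}_C|(a)=(f\mapsto\iota(\mathcal Of(a)))$. An adjunction $F\dashv G$ with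 unit $\eta$ is idempotent if $\eta_{G}$ is invertible (equivalently the induced monad is idempotent). *)

theory Defs
  imports "HOL-Analysis.Abstract_Topology" "HOL-Algebra.Complete_Lattice"
begin

text \<open>
  A category has a set of objects and a family of hom-sets, which need not be disjoint; hence
  composition and the arrow part of a functor also take the objects as arguments.
  \<open>Comp C A B D g f\<close> is the composite of \<open>f : A \<rightarrow> B\<close> and \<open>g : B \<rightarrow> D\<close>.
\<close>

record ('o, 'm) category =
  Obj :: "'o set"
  Hom :: "'o \<Rightarrow> 'o \<Rightarrow> 'm set"
  Id :: "'o \<Rightarrow> 'm"
  Comp :: "'o \<Rightarrow> 'o \<Rightarrow> 'o \<Rightarrow> 'm \<Rightarrow> 'm \<Rightarrow> 'm"

definition is_category :: "('o, 'm) category \<Rightarrow> bool" where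
  "is_category C \<longleftrightarrow>
     (\<forall>A\<in>Obj C. Id C A \<in> Hom C A A) \<and>
     (\<forall>A\<in>Obj C. \<forall>B\<in>Obj C. \<forall>D\<in>Obj C. \<forall>f\<in>Hom C A B. \<forall>g\<in>Hom C B D.
        Comp C A B D g f \<in> Hom C A D) \<and>
     (\<forall>A\<in>Obj C. \<forall>B\<in>Obj C. \<forall>f\<in>Hom C A B.
        Comp C A A B f (Id C A) = f \<and> Comp C A B B (Id C B) f = f) \<and>
     (\<forall>A\<in>Obj C. \<forall>B\<in>Obj C. \<forall>D\<in>Obj C. \<forall>E\<in>Obj C.
        \<forall>f\<in>Hom C A B. \<forall>g\<in>Hom C B D. \<forall>h\<in>Hom C D E.
          Comp C A B E (Comp C B D E h g) f = Comp C A D E h (Comp C A B D g f))"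

definition op_category :: "('o, 'm) category \<Rightarrow> ('o, 'm) category" where
  "op_category C =
     \<lparr>Obj = Obj C, Hom = (\<lambda>A B. Hom C B A), Id = Id C, Comp = (\<lambda>A B D g f. Comp C D B A f g)\<rparr>"

definition full_subcategory :: "('o, 'm) category \<Rightarrow> 'o set \<Rightarrow> ('o, 'm) category" where
  "full_subcategory C S = C\<lparr>Obj := Obj C \<inter> S\<rparr>"

definition iso_arrow :: "('o, 'm) category \<Rightarrow> 'o \<Rightarrow> 'o \<Rightarrow> 'm \<Rightarrow> bool" where
  "iso_arrow C A B f \<longleftrightarrow> f \<in> Hom C A B \<and>
     (\<exists>g\<in>Hom C B A. Comp C A B A g f = Id C A \<and> Comp C B A B f g = Id C B)"

record ('o, 'm, 'p, 'n) cat_functor =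
  OMap :: "'o \<Rightarrow> 'p"
  AMap :: "'o \<Rightarrow> 'o \<Rightarrow> 'm \<Rightarrow> 'n"

definition is_functor ::
  "('o, 'm) category \<Rightarrow> ('p, 'n) category \<Rightarrow> ('o, 'm, 'p, 'n) cat_functor \<Rightarrow> bool" where
  "is_functor C D F \<longleftrightarrow>
     (\<forall>A\<in>Obj C. OMap F A \<in> Obj D) \<and>
     (\<forall>A\<in>Obj C. \<forall>B\<in>Obj C. \<forall>f\<in>Hom C A B. AMap F A B f \<in> Hom D (OMap F A) (OMap F B)) \<and>
     (\<forall>A\<in>Obj C. AMap F A A (Id C A) = Id D (OMap F A)) \<and>
     (\<forall>A\<in>Obj C. \<forall>B\<in>Obj C. \<forall>E\<in>Obj C. \<forall>f\<in>Hom C A B. \<forall>g\<in>Hom C B E.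
        AMap F A E (Comp C A B E g f) =
          Comp D (OMap F A) (OMap F B) (OMap F E) (AMap F B E g) (AMap F A B f))"

definition faithful :: "('o, 'm) category \<Rightarrow> ('o, 'm, 'p, 'n) cat_functor \<Rightarrow> bool" where
  "faithful C F \<longleftrightarrow> (\<forall>A\<in>Obj C. \<forall>B\<in>Obj C. inj_on (AMap F A B) (Hom C A B))"

definition id_functor :: "('o, 'm, 'o, 'm) cat_functor" where
  "id_functor = \<lparr>OMap = (\<lambda>A. A), AMap = (\<lambda>A B f. f)\<rparr>"

definition comp_functor ::
  "('p, 'n, 'q, 'k) cat_functor \<Rightarrow> ('o, 'm, 'p, 'n) cat_functor \<Rightarrow> ('o, 'm, 'q, 'k) cat_functor" where
  "comp_functor G F =
     \<lparr>OMap = (\<lambda>A. OMap G (OMap F A)),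
      AMap = (\<lambda>A B f. AMap G (OMap F A) (OMap F B) (AMap F A B f))\<rparr>"

definition nat_trans ::
  "('o, 'm) category \<Rightarrow> ('p, 'n) category \<Rightarrow>
   ('o, 'm, 'p, 'n) cat_functor \<Rightarrow> ('o, 'm, 'p, 'n) cat_functor \<Rightarrow> ('o \<Rightarrow> 'n) \<Rightarrow> bool" where
  "nat_trans C D F G \<tau> \<longleftrightarrow>
     (\<forall>A\<in>Obj C. \<tau> A \<in> Hom D (OMap F A) (OMap G A)) \<and>
     (\<forall>A\<in>Obj C. \<forall>B\<in>Obj C. \<forall>f\<in>Hom C A B.
        Comp D (OMap F A) (OMap F B) (OMap G B) (\<tau> B) (AMap F A B f) =
        Comp D (OMap F A) (OMap G A) (OMap G B) (AMap G A B f) (\<tau> A))"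

text \<open>\<open>F : C \<rightarrow> D\<close> is left adjoint to \<open>G : D \<rightarrow> C\<close> with unit \<open>\<eta>\<close> and counit \<open>\<epsilon>\<close>.\<close>

definition adjunction ::
  "('o, 'm) category \<Rightarrow> ('p, 'n) category \<Rightarrow>
   ('o, 'm, 'p, 'n) cat_functor \<Rightarrow> ('p, 'n, 'o, 'm) cat_functor \<Rightarrow>
   ('o \<Rightarrow> 'm) \<Rightarrow> ('p \<Rightarrow> 'n) \<Rightarrow> bool" where
  "adjunction C D F G \<eta> \<epsilon> \<longleftrightarrow>
     is_category C \<and> is_category D \<and> is_functor C D F \<and> is_functor D C G \<and>
     nat_trans C C id_functor (comp_functor G F) \<eta> \<and>
     nat_trans D D (comp_functor F G) id_functor \<epsilon> \<and>
     (\<forall>A\<in>Obj C.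
        Comp D (OMap F A) (OMap F (OMap G (OMap F A))) (OMap F A)
          (\<epsilon> (OMap F A)) (AMap F A (OMap G (OMap F A)) (\<eta> A)) = Id D (OMap F A)) \<and>
     (\<forall>X\<in>Obj D.
        Comp C (OMap G X) (OMap G (OMap F (OMap G X))) (OMap G X)
          (AMap G (OMap F (OMap G X)) X (\<epsilon> X)) (\<eta> (OMap G X)) = Id C (OMap G X))"

definition idempotent_adjunction ::
  "('o, 'm) category \<Rightarrow> ('p, 'n) category \<Rightarrow>
   ('o, 'm, 'p, 'n) cat_functor \<Rightarrow> ('p, 'n, 'o, 'm) cat_functor \<Rightarrow>
   ('o \<Rightarrow> 'm) \<Rightarrow> ('p \<Rightarrow> 'n) \<Rightarrow> bool" where
  "idempotent_adjunction C D F G \<eta> \<epsilon> \<longleftrightarrow>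
     adjunction C D F G \<eta> \<epsilon> \<and>
     (\<forall>X\<in>Obj D. iso_arrow C (OMap G X) (OMap G (OMap F (OMap G X))) (\<eta> (OMap G X)))"

definition is_frame :: "'a gorder \<Rightarrow> bool" where
  "is_frame L \<longleftrightarrow> complete_lattice L \<and>
     (\<forall>a\<in>carrier L. \<forall>S\<subseteq>carrier L. a \<sqinter>\<^bsub>L\<^esub> (\<Squnion>\<^bsub>L\<^esub> S) = \<Squnion>\<^bsub>L\<^esub> ((\<lambda>s. a \<sqinter>\<^bsub>L\<^esub> s) ` S))"

text \<open>Functions between carriers are extensional, so that equality of arrows is equality of terms.\<close>

definition frame_hom :: "'a gorder \<Rightarrow> 'b gorder \<Rightarrow> ('a \<Rightarrow> 'b) \<Rightarrow> bool" where
  "frame_hom L M f \<longleftrightarrow> f \<in> carrier L \<rightarrow>\<^sub>E carrier M \<and>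
     (\<forall>S\<subseteq>carrier L. f (\<Squnion>\<^bsub>L\<^esub> S) = \<Squnion>\<^bsub>M\<^esub> (f ` S)) \<and>
     (\<forall>a\<in>carrier L. \<forall>b\<in>carrier L. f (a \<sqinter>\<^bsub>L\<^esub> b) = f a \<sqinter>\<^bsub>M\<^esub> f b) \<and>
     f \<top>\<^bsub>L\<^esub> = \<top>\<^bsub>M\<^esub>"

definition frame_iso :: "'a gorder \<Rightarrow> 'b gorder \<Rightarrow> ('a \<Rightarrow> 'b) \<Rightarrow> bool" where
  "frame_iso L M f \<longleftrightarrow> frame_hom L M f \<and>
     (\<exists>g. frame_hom M L g \<and> (\<forall>a\<in>carrier L. g (f a) = a) \<and> (\<forall>b\<in>carrier M. f (g b) = b))"

definition Frm :: "('a gorder, 'a \<Rightarrow> 'a) category" where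
  "Frm = \<lparr>Obj = {L. is_frame L}, Hom = (\<lambda>L M. {f. frame_hom L M f}),
          Id = (\<lambda>L. \<lambda>a\<in>carrier L. a), Comp = (\<lambda>L M N g f. compose (carrier L) g f)\<rparr>"

definition two_frame :: "bool gorder" where
  "two_frame = \<lparr>carrier = UNIV, eq = (=), le = (\<le>)\<rparr>"

definition cont :: "'x topology \<Rightarrow> 'y topology \<Rightarrow> ('x \<Rightarrow> 'y) set" where
  "cont X Y = {f \<in> extensional (topspace X). continuous_map X Y f}"

definition Top :: "('u topology, 'u \<Rightarrow> 'u) category" where
  "Top = \<lparr>Obj = UNIV, Hom = cont,
          Id = (\<lambda>X. \<lambda>x\<in>topspace X. x), Comp = (\<lambda>X Y Z g f. compose (topspace X) g f)\<rparr>"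

text \<open>The points \<open>0\<close> and \<open>1\<close> are \<open>False\<close> and \<open>True\<close>.\<close>

definition sierpinski :: "bool topology" where
  "sierpinski = topology (\<lambda>U. U = {} \<or> U = {True} \<or> U = UNIV)"

definition lifts ::
  "('o, 'm) category \<Rightarrow> ('o, 'm, 'p, 'n) cat_functor \<Rightarrow> 'o \<Rightarrow> 'o \<Rightarrow> 'n \<Rightarrow> bool" where
  "lifts C U A B h \<longleftrightarrow> (\<exists>p\<in>Hom C A B. AMap U A B p = h)"

definition lift_of ::
  "('o, 'm) category \<Rightarrow> ('o, 'm, 'p, 'n) cat_functor \<Rightarrow> 'o \<Rightarrow> 'o \<Rightarrow> 'n \<Rightarrow> 'm" where
  "lift_of C U A B h = (THE p. p \<in> Hom C A B \<and> AMap U A B p = h)"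

text \<open>
  Cartesian lift, with respect to a set-valued functor \<open>U\<close>, of the family
  \<open>f i : X \<rightarrow> U K\<close> (\<open>i \<in> I\<close>).  The set \<open>X\<close> may live in another type than the sets \<open>U A\<close>;
  an isomorphism of sets is a bijection.
\<close>

definition cartesian_lift ::
  "('o, 'm) category \<Rightarrow> ('o, 'm, 'a set, 'a \<Rightarrow> 'a) cat_functor \<Rightarrow>
   'i set \<Rightarrow> ('i \<Rightarrow> 's \<Rightarrow> 'a) \<Rightarrow> 's set \<Rightarrow> 'o \<Rightarrow> 'o \<Rightarrow> ('a \<Rightarrow> 's) \<Rightarrow> bool" where
  "cartesian_lift C U I f X K Xbar \<theta> \<longleftrightarrow>
     Xbar \<in> Obj C \<and> bij_betw \<theta> (OMap U Xbar) X \<and>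
     (\<forall>D\<in>Obj C. \<forall>h \<in> OMap U D \<rightarrow>\<^sub>E OMap U Xbar.
        lifts C U D Xbar h \<longleftrightarrow>
        (\<forall>i\<in>I. lifts C U D K (\<lambda>a\<in>OMap U D. f i (\<theta> (h a)))))"

text \<open>
  Hom-sets and points of spaces are subsets of one type \<open>'u\<close>, which plays the role of the universe
  of elements of small sets, so that the spaces \<open>pt C\<close> are objects of \<open>Top\<close>.
\<close>

record ('o, 'u, 'a) pfc =
  Ofun :: "('o, 'u, 'a gorder, 'a \<Rightarrow> 'a) cat_functor"
  Cat :: "('o, 'u) category"
  Two :: "'o"
  Iota :: "'a \<Rightarrow> bool"

definition pfc_category :: "('o, 'u, 'a) pfc \<Rightarrow> bool" where
  "pfc_category P \<longleftrightarrow>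
     is_category (Cat P) \<and> is_functor (Cat P) Frm (Ofun P) \<and> faithful (Cat P) (Ofun P) \<and>
     Two P \<in> Obj (Cat P) \<and> frame_iso (OMap (Ofun P) (Two P)) two_frame (Iota P)"

text \<open>The functor \<open>|O(-)|\<close> to sets; the underlying function of a frame homomorphism is itself.\<close>

definition UO :: "('o, 'u, 'a) pfc \<Rightarrow> ('o, 'u, 'a set, 'a \<Rightarrow> 'a) cat_functor" where
  "UO P = \<lparr>OMap = (\<lambda>A. carrier (OMap (Ofun P) A)), AMap = AMap (Ofun P)\<rparr>"

definition iota_inv :: "('o, 'u, 'a) pfc \<Rightarrow> bool \<Rightarrow> 'a" where
  "iota_inv P = inv_into (OMap (UO P) (Two P)) (Iota P)"

definition chi :: "'x \<Rightarrow> ('x \<Rightarrow> bool) \<Rightarrow> bool" where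
  "chi x g = g x"

definition chi_cartesian_lift ::
  "('o, 'u, 'a) pfc \<Rightarrow> 'x topology \<Rightarrow> 'o \<Rightarrow> ('a \<Rightarrow> 'x \<Rightarrow> bool) \<Rightarrow> bool" where
  "chi_cartesian_lift P X W \<theta> \<longleftrightarrow>
     cartesian_lift (Cat P) (UO P) (topspace X) (\<lambda>x g. iota_inv P (chi x g)) (cont X sierpinski)
       (Two P) W \<theta>"

text \<open>
  The condition defining the objects of \<open>Top\<^sub>C\<close> is stated for spaces with points in any
  type, in particular for \<^const>\<open>sierpinski\<close>.
\<close>

definition in_TopC :: "('o, 'u, 'a) pfc \<Rightarrow> 'x topology \<Rightarrow> bool" where
  "in_TopC P X \<longleftrightarrow> (\<exists>W \<theta>. chi_cartesian_lift P X W \<theta>)"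

definition TopC :: "('o, 'u, 'a) pfc \<Rightarrow> ('u topology, 'u \<Rightarrow> 'u) category" where
  "TopC P = full_subcategory Top {X. in_TopC P X}"

definition pt_space :: "('o, 'u, 'a) pfc \<Rightarrow> 'o \<Rightarrow> 'u topology" where
  "pt_space P A = topology (\<lambda>U. \<exists>a\<in>OMap (UO P) A.
     U = {f \<in> Hom (Cat P) A (Two P). Iota P (AMap (Ofun P) A (Two P) f a)})"

definition sfc_category :: "('o, 'u, 'a) pfc \<Rightarrow> bool" where
  "sfc_category P \<longleftrightarrow>
     pfc_category P \<and> in_TopC P sierpinski \<and> (\<forall>A\<in>Obj (Cat P). in_TopC P (pt_space P A))"

text \<open>
  Cartesian lifts are unique only up to isomorphism: \<open>W X\<close> and \<open>\<theta> X\<close> below are a choice of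
  \<open>\<Omega>\<^sub>C X\<close> and \<open>\<theta>\<^sub>X\<close> for each \<open>X\<close> in \<open>Top\<^sub>C\<close>.
\<close>

definition chosen_lifts ::
  "('o, 'u, 'a) pfc \<Rightarrow> ('u topology \<Rightarrow> 'o) \<Rightarrow> ('u topology \<Rightarrow> 'a \<Rightarrow> 'u \<Rightarrow> bool) \<Rightarrow> bool" where
  "chosen_lifts P W \<theta> \<longleftrightarrow> (\<forall>X\<in>Obj (TopC P). chi_cartesian_lift P X (W X) (\<theta> X))"

definition theta_inv ::
  "('o, 'u, 'a) pfc \<Rightarrow> ('u topology \<Rightarrow> 'o) \<Rightarrow> ('u topology \<Rightarrow> 'a \<Rightarrow> 'u \<Rightarrow> bool) \<Rightarrow>
   'u topology \<Rightarrow> ('u \<Rightarrow> bool) \<Rightarrow> 'a" where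
  "theta_inv P W \<theta> X = inv_into (OMap (UO P) (W X)) (\<theta> X)"

definition chi_bar ::
  "('o, 'u, 'a) pfc \<Rightarrow> ('u topology \<Rightarrow> 'o) \<Rightarrow> ('u topology \<Rightarrow> 'a \<Rightarrow> 'u \<Rightarrow> bool) \<Rightarrow>
   'u topology \<Rightarrow> 'u \<Rightarrow> 'u" where
  "chi_bar P W \<theta> X x =
     lift_of (Cat P) (UO P) (W X) (Two P) (\<lambda>a\<in>OMap (UO P) (W X). iota_inv P (chi x (\<theta> X a)))"

text \<open>\<open>pt : C \<rightarrow> Top\<^sub>C\<^sup>o\<^sup>p\<close>: an arrow \<open>f : A \<rightarrow> B\<close> yields the continuous map \<open>pt B \<rightarrow> pt A\<close>.\<close>

definition pt_functor :: "('o, 'u, 'a) pfc \<Rightarrow> ('o, 'u, 'u topology, 'u \<Rightarrow> 'u) cat_functor" where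
  "pt_functor P =
     \<lparr>OMap = pt_space P,
      AMap = (\<lambda>A B f. \<lambda>g\<in>Hom (Cat P) B (Two P). Comp (Cat P) A B (Two P) g f)\<rparr>"

text \<open>
  \<open>\<Omega> : Top\<^sub>C\<^sup>o\<^sup>p \<rightarrow> C\<close>: an arrow from \<open>Y\<close> to \<open>X\<close> in the opposite category is a
  continuous map \<open>f : X \<rightarrow> Y\<close>.
\<close>

definition Omega_functor ::
  "('o, 'u, 'a) pfc \<Rightarrow> ('u topology \<Rightarrow> 'o) \<Rightarrow> ('u topology \<Rightarrow> 'a \<Rightarrow> 'u \<Rightarrow> bool) \<Rightarrow>
   ('u topology, 'u \<Rightarrow> 'u, 'o, 'u) cat_functor" where
  "Omega_functor P W \<theta> =
     \<lparr>OMap = W,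
      AMap = (\<lambda>Y X f. lift_of (Cat P) (UO P) (W Y) (W X)
        (\<lambda>a\<in>OMap (UO P) (W Y). theta_inv P W \<theta> X (compose (topspace X) (\<theta> Y a) f)))\<rparr>"

definition sigma ::
  "('o, 'u, 'a) pfc \<Rightarrow> ('u topology \<Rightarrow> 'o) \<Rightarrow> ('u topology \<Rightarrow> 'a \<Rightarrow> 'u \<Rightarrow> bool) \<Rightarrow>
   'u topology \<Rightarrow> 'u \<Rightarrow> 'u" where
  "sigma P W \<theta> X = (\<lambda>x\<in>topspace X. chi_bar P W \<theta> X x)"

definition eta ::
  "('o, 'u, 'a) pfc \<Rightarrow> ('u topology \<Rightarrow> 'o) \<Rightarrow> ('u topology \<Rightarrow> 'a \<Rightarrow> 'u \<Rightarrow> bool) \<Rightarrow> 'o \<Rightarrow> 'u" where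
  "eta P W \<theta> A =
     (THE p. p \<in> Hom (Cat P) A (W (pt_space P A)) \<and>
        (\<forall>a\<in>OMap (UO P) A.
           \<theta> (pt_space P A) (AMap (UO P) A (W (pt_space P A)) p a) =
           (\<lambda>f\<in>Hom (Cat P) A (Two P). Iota P (AMap (Ofun P) A (Two P) f a))))"

end

theory Submission
  imports Defs
begin

text \<open>
  Write \<open>|A|\<close> for the carrier of \<open>O A\<close>.  Since \<open>O\<close> is faithful and \<open>\<iota>\<close> and \<open>\<theta>\<^sub>X\<close> are
  injective, an arrow \<open>f : A \<rightarrow> 2\<^sub>C\<close> is determined by the truth values \<open>\<iota> (O f a)\<close> for \<open>a \<in> |A|\<close>,
  and an arrow \<open>p : A \<rightarrow> \<Omega> X\<close> by the truth values \<open>\<theta>\<^sub>X (O p a) x\<close>, where \<open>x\<close> ranges over the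
  points of \<open>X\<close>.  Conversely, by cartesianness a function \<open>h : |A| \<rightarrow> |\<Omega> X|\<close> underlies an arrow
  as soon as, for each \<open>x\<close> separately, the truth values \<open>\<theta>\<^sub>X (h a) x\<close> are those of an arrow
  \<open>A \<rightarrow> 2\<^sub>C\<close>.  In these terms the structure maps are

    \<^item> \<open>\<iota> (O \<chi>\<^sub>x a) = \<theta>\<^sub>X a x\<close> for the lift \<open>\<chi>\<^sub>x : \<Omega> X \<rightarrow> 2\<^sub>C\<close> of evaluation at \<open>x\<close>,
    \<^item> \<open>\<theta>\<^sub>X (O (\<Omega> f) a) x = \<theta>\<^sub>Y a (f x)\<close> for \<open>f : X \<rightarrow> Y\<close>,
    \<^item> \<open>\<theta> (O \<eta>\<^sub>A a) f = \<iota> (O f a)\<close>, with \<open>\<theta>\<close> at \<open>pt A\<close>,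

  and naturality and the triangle identities follow by comparing truth values.

  For idempotency, the triangle identity \<open>\<Omega> \<sigma>\<^sub>X \<circ> \<eta>\<^bsub>\<Omega> X\<^esub> = id\<close> gives a left inverse of
  \<open>\<eta>\<^bsub>\<Omega> X\<^esub>\<close>.  On the other hand \<open>O \<eta>\<^sub>A\<close> is surjective for every \<open>A\<close>: an element of
  \<open>|\<Omega> pt A|\<close> amounts to an open set of \<open>pt A\<close>, and by definition every such set has the form
  \<open>{f. \<iota> (O f a)}\<close> with \<open>a \<in> |A|\<close>.  Hence \<open>O \<eta>\<^bsub>\<Omega> X\<^esub>\<close> is a bijection with inverse
  \<open>O (\<Omega> \<sigma>\<^sub>X)\<close>, and faithfulness of \<open>O\<close> turns this into an equality of arrows.
\<close>

section \<open>Truth values, the Sierpinski space and the category of spaces\<close>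

lemma sup_two_frame: "\<Squnion>\<^bsub>two_frame\<^esub> S \<longleftrightarrow> True \<in> S"
proof -
  have "least two_frame x (Upper two_frame S) \<longleftrightarrow> x = (True \<in> S)" for x
    unfolding least_def Upper_def two_frame_def by (cases "True \<in> S"; cases x) (simp_all, metis+)
  then show ?thesis unfolding Lattice.sup_def by (simp only: some_eq_trivial)
qed

lemma meet_two_frame: "a \<sqinter>\<^bsub>two_frame\<^esub> b \<longleftrightarrow> a \<and> b"
proof -
  have "greatest two_frame x (Lower two_frame {a, b}) \<longleftrightarrow> x = (a \<and> b)" for x
    unfolding greatest_def Lower_def two_frame_def by auto
  then show ?thesis unfolding meet_def Lattice.inf_def by simp
qed

lemma top_two_frame: "\<top>\<^bsub>two_frame\<^esub>"
proof -
  have "greatest two_frame x (carrier two_frame) \<longleftrightarrow> x = True" for x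
    unfolding greatest_def two_frame_def by auto
  then show ?thesis
    unfolding top_def using someI[of "\<lambda>x. greatest two_frame x (carrier two_frame)" True] by simp
qed

lemma openin_sierpinski: "openin sierpinski U \<longleftrightarrow> U = {} \<or> U = {True} \<or> U = UNIV"
proof -
  have "istopology (\<lambda>U. U = {} \<or> U = {True} \<or> U = (UNIV :: bool set))"
    unfolding istopology_def
  proof (intro conjI allI impI)
    fix K :: "bool set set"
    assume "\<forall>U\<in>K. U = {} \<or> U = {True} \<or> U = UNIV"
    then have "K \<subseteq> {{}, {True}, UNIV}" by blast
    then show "\<Union>K = {} \<or> \<Union>K = {True} \<or> \<Union>K = UNIV" by blast
  qed auto
  then show ?thesis unfolding sierpinski_def by (simp add: topology_inverse')
qed

lemma continuous_map_sierpinski: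
  "continuous_map X sierpinski g \<longleftrightarrow> openin X {x \<in> topspace X. g x}"
proof -
  have top: "topspace sierpinski = UNIV"
    unfolding topspace_def by (auto simp: openin_sierpinski)
  show ?thesis
    unfolding continuous_map_def by (auto simp: top openin_sierpinski)
qed

lemma cont_in: "\<lbrakk>f \<in> cont X Y; x \<in> topspace X\<rbrakk> \<Longrightarrow> f x \<in> topspace Y"
  unfolding cont_def using continuous_map_funspace[of X Y f] by blast

lemma cont_comp:
  assumes "f \<in> cont X Y" "g \<in> cont Y Z"
  shows "compose (topspace X) g f \<in> cont X Z"
proof -
  have "continuous_map X Z (g \<circ> f)"
    using assms unfolding cont_def by (blast intro: continuous_map_compose)
  then have "continuous_map X Z (compose (topspace X) g f)"
    by (rule continuous_map_eq) (simp add: compose_eq)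
  then show ?thesis unfolding cont_def by simp
qed

lemma cont_id: "(\<lambda>x\<in>topspace X. x) \<in> cont X X"
proof -
  have "continuous_map X X (\<lambda>x\<in>topspace X. x)"
    by (rule continuous_map_eq[OF continuous_map_id]) simp
  then show ?thesis unfolding cont_def by simp
qed

lemma is_category_Top: "is_category Top"
proof -
  have fn: "f \<in> topspace X \<rightarrow> topspace Y" "f \<in> extensional (topspace X)"
    if "f \<in> cont X Y" for f :: "'u \<Rightarrow> 'u" and X Y
    using that cont_in[OF that] unfolding cont_def by blast+
  note units = compose_Id[OF fn] Id_compose[OF fn] and assoc = compose_assoc[OF fn(1), symmetric]
  show ?thesis
    unfolding is_category_def Top_def category.simps
    by (intro conjI ballI cont_id cont_comp units assoc)
qed

lemma is_category_full_subcategory: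
  "is_category C \<Longrightarrow> is_category (full_subcategory C S)"
  unfolding is_category_def full_subcategory_def by simp

lemma is_category_op: "is_category C \<Longrightarrow> is_category (op_category C)"
  unfolding is_category_def op_category_def by simp

section \<open>Arrows and their truth values\<close>

text \<open>
  A PFC-category whose spaces of points all belong to \<open>Top\<^sub>C\<close>, together with a choice of
  cartesian lifts for the spaces in \<open>Top\<^sub>C\<close>.
\<close>

locale pfc_with_lifts =
  fixes P :: "('o, 'u, 'a) pfc"
    and W :: "'u topology \<Rightarrow> 'o"
    and \<theta> :: "'u topology \<Rightarrow> 'a \<Rightarrow> 'u \<Rightarrow> bool"
  assumes pfc: "pfc_category P"
    and pt_in_TopC: "A \<in> Obj (Cat P) \<Longrightarrow> in_TopC P (pt_space P A)"
    and chosen: "chosen_lifts P W \<theta>"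
begin

abbreviation "ob \<equiv> Obj (Cat P)"
abbreviation "hom \<equiv> Hom (Cat P)"
abbreviation "cmp \<equiv> Comp (Cat P)"
abbreviation "two \<equiv> Two P"
abbreviation "car A \<equiv> carrier (OMap (Ofun P) A)"
abbreviation "arr \<equiv> AMap (Ofun P)"

text \<open>The truth value of a point \<open>f : A \<rightarrow> 2\<^sub>C\<close> at \<open>a \<in> |A|\<close>.\<close>
abbreviation "val A f a \<equiv> Iota P (arr A two f a)"

lemma cat: "is_category (Cat P)"
  and fun_O: "is_functor (Cat P) Frm (Ofun P)"
  and faithful_O: "faithful (Cat P) (Ofun P)"
  and two: "two \<in> ob"
  and iota: "frame_iso (OMap (Ofun P) two) two_frame (Iota P)"
  using pfc unfolding pfc_category_def by auto

lemma id_hom: "A \<in> ob \<Longrightarrow> Id (Cat P) A \<in> hom A A"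
  and cmp_hom: "\<lbrakk>A \<in> ob; B \<in> ob; D \<in> ob; f \<in> hom A B; g \<in> hom B D\<rbrakk> \<Longrightarrow> cmp A B D g f \<in> hom A D"
  and cmp_id: "\<lbrakk>A \<in> ob; B \<in> ob; f \<in> hom A B\<rbrakk> \<Longrightarrow> cmp A A B f (Id (Cat P) A) = f"
  and cmp_assoc: "\<lbrakk>A \<in> ob; B \<in> ob; D \<in> ob; E \<in> ob; f \<in> hom A B; g \<in> hom B D; h \<in> hom D E\<rbrakk>
    \<Longrightarrow> cmp A B E (cmp B D E h g) f = cmp A D E h (cmp A B D g f)"
  using cat unfolding is_category_def by blast+

lemma UO_simps [simp]: "OMap (UO P) A = car A" "AMap (UO P) = arr"
  unfolding UO_def by simp_all

lemma frame_O: "A \<in> ob \<Longrightarrow> is_frame (OMap (Ofun P) A)"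
  using fun_O unfolding is_functor_def Frm_def by simp

lemma frame_hom_arr:
  "\<lbrakk>A \<in> ob; B \<in> ob; f \<in> hom A B\<rbrakk> \<Longrightarrow> frame_hom (OMap (Ofun P) A) (OMap (Ofun P) B) (arr A B f)"
  using fun_O unfolding is_functor_def Frm_def by simp

lemma arr_PiE: "\<lbrakk>A \<in> ob; B \<in> ob; f \<in> hom A B\<rbrakk> \<Longrightarrow> arr A B f \<in> car A \<rightarrow>\<^sub>E car B"
  using frame_hom_arr unfolding frame_hom_def by blast

lemma arr_in: "\<lbrakk>A \<in> ob; B \<in> ob; f \<in> hom A B; a \<in> car A\<rbrakk> \<Longrightarrow> arr A B f a \<in> car B"
  using arr_PiE by blast

lemma arr_id: "\<lbrakk>A \<in> ob; a \<in> car A\<rbrakk> \<Longrightarrow> arr A A (Id (Cat P) A) a = a"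
  using fun_O unfolding is_functor_def Frm_def by simp

lemma arr_cmp:
  "\<lbrakk>A \<in> ob; B \<in> ob; D \<in> ob; f \<in> hom A B; g \<in> hom B D; a \<in> car A\<rbrakk>
   \<Longrightarrow> arr A D (cmp A B D g f) a = arr B D g (arr A B f a)"
  using fun_O unfolding is_functor_def Frm_def by (simp add: compose_def)

lemma arr_eqI:
  assumes "A \<in> ob" "B \<in> ob" "f \<in> hom A B" "g \<in> hom A B"
    and "\<And>a. a \<in> car A \<Longrightarrow> arr A B f a = arr A B g a"
  shows "f = g"
proof -
  have "arr A B f = arr A B g"
    using PiE_ext[OF arr_PiE arr_PiE] assms by blast
  then show ?thesis
    using faithful_O assms unfolding faithful_def inj_on_def by blast
qed

lemma lift_of_eq:
  assumes "A \<in> ob" "B \<in> ob" "p \<in> hom A B" "arr A B p = h"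
  shows "lift_of (Cat P) (UO P) A B h = p"
  unfolding lift_of_def UO_simps
  using assms faithful_O unfolding faithful_def inj_on_def by (intro the_equality) auto

lemma bij_iota: "bij_betw (Iota P) (car two) UNIV"
proof -
  obtain g where g: "frame_hom two_frame (OMap (Ofun P) two) g"
    and inv: "\<forall>a\<in>car two. g (Iota P a) = a" "\<forall>b. Iota P (g b) = b"
    using iota unfolding frame_iso_def two_frame_def by auto
  have "g b \<in> car two" for b
    using g unfolding frame_hom_def two_frame_def by auto
  then show ?thesis
    using inv by (intro bij_betw_byWitness[where f' = g]) auto
qed

lemma iota_iota_inv: "Iota P (iota_inv P b) = b"
proof -
  have "b \<in> Iota P ` car two" using bij_iota by (simp add: bij_betw_def)
  then show ?thesis
    unfolding iota_inv_def UO_simps by (rule f_inv_into_f)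
qed

lemma iota_inv_iota: "a \<in> car two \<Longrightarrow> iota_inv P (Iota P a) = a"
  unfolding iota_inv_def UO_simps using bij_iota by (simp add: bij_betw_def)

lemma point_eqI:
  assumes "A \<in> ob" "f \<in> hom A two" "g \<in> hom A two"
    and "\<And>a. a \<in> car A \<Longrightarrow> val A f a = val A g a"
  shows "f = g"
proof (rule arr_eqI[OF assms(1) two assms(2,3)])
  fix a assume a: "a \<in> car A"
  have "arr A two f a = iota_inv P (val A f a)"
    by (rule iota_inv_iota[OF arr_in[OF assms(1) two assms(2) a], symmetric])
  also have "\<dots> = iota_inv P (val A g a)"
    by (simp only: assms(4)[OF a])
  also have "\<dots> = arr A two g a"
    by (rule iota_inv_iota[OF arr_in[OF assms(1) two assms(3) a]])
  finally show "arr A two f a = arr A two g a" .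
qed

lemma frame_hom_iota: "frame_hom (OMap (Ofun P) two) two_frame (Iota P)"
  using iota unfolding frame_iso_def by blast

lemma val_sup:
  assumes "A \<in> ob" "f \<in> hom A two" "S \<subseteq> car A"
  shows "val A f (\<Squnion>\<^bsub>OMap (Ofun P) A\<^esub> S) \<longleftrightarrow> (\<exists>s\<in>S. val A f s)"
proof -
  note f = frame_hom_arr[OF assms(1) two assms(2)]
  have S: "arr A two f ` S \<subseteq> car two" using assms arr_in two by blast
  have "val A f (\<Squnion>\<^bsub>OMap (Ofun P) A\<^esub> S) = \<Squnion>\<^bsub>two_frame\<^esub> (Iota P ` arr A two f ` S)"
    using f frame_hom_iota S assms(3) unfolding frame_hom_def by simp
  then show ?thesis by (auto simp: sup_two_frame)
qed

lemma val_meet: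
  assumes "A \<in> ob" "f \<in> hom A two" "a \<in> car A" "b \<in> car A"
  shows "val A f (a \<sqinter>\<^bsub>OMap (Ofun P) A\<^esub> b) \<longleftrightarrow> val A f a \<and> val A f b"
  using frame_hom_arr[OF assms(1) two assms(2)] frame_hom_iota arr_in[OF assms(1) two assms(2)]
    assms(3,4) unfolding frame_hom_def by (simp add: meet_two_frame)

lemma val_top:
  assumes "A \<in> ob" "f \<in> hom A two"
  shows "val A f \<top>\<^bsub>OMap (Ofun P) A\<^esub>"
  using frame_hom_arr[OF assms(1) two assms(2)] frame_hom_iota top_two_frame
  unfolding frame_hom_def by simp

section \<open>Spaces of points\<close>

lemma openin_pt:
  assumes A: "A \<in> ob"
  shows "openin (pt_space P A) U \<longleftrightarrow> (\<exists>a\<in>car A. U = {f \<in> hom A two. val A f a})"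
proof -
  let ?L = "OMap (Ofun P) A"
  let ?E = "\<lambda>a. {f \<in> hom A two. val A f a}"
  interpret L: complete_lattice ?L
    using frame_O[OF A] unfolding is_frame_def by blast
  have "istopology (\<lambda>U. \<exists>a\<in>car A. U = ?E a)"
    unfolding istopology_def
  proof (intro conjI allI impI)
    fix U V assume "\<exists>a\<in>car A. U = ?E a" "\<exists>a\<in>car A. V = ?E a"
    then obtain a b where ab: "a \<in> car A" "b \<in> car A" and "U = ?E a" "V = ?E b" by blast
    then have "U \<inter> V = ?E (a \<sqinter>\<^bsub>?L\<^esub> b)"
      using val_meet[OF A] by auto
    moreover have "a \<sqinter>\<^bsub>?L\<^esub> b \<in> car A" using ab by simp
    ultimately show "\<exists>c\<in>car A. U \<inter> V = ?E c" by blast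
  next
    define E where "E = ?E"
    fix K assume "\<forall>U\<in>K. \<exists>a\<in>car A. U = ?E a"
    then have *: "\<forall>U\<in>K. \<exists>a\<in>car A. U = E a" unfolding E_def .
    let ?S = "{a \<in> car A. E a \<in> K}"
    have "U \<in> E ` ?S" if U: "U \<in> K" for U
    proof -
      obtain a where "a \<in> car A" "U = E a" using bspec[OF * U] by (rule bexE)
      then show ?thesis using U by (intro image_eqI[of U E a]) simp_all
    qed
    then have "K = E ` ?S" by (intro equalityI subsetI) (simp, clarsimp)
    then have "\<Union>K = \<Union>(E ` ?S)" by (rule arg_cong)
    also have "\<dots> = ?E (\<Squnion>\<^bsub>?L\<^esub> ?S)"
      using val_sup[OF A, of _ ?S] unfolding E_def by auto
    finally have "\<Union>K = ?E (\<Squnion>\<^bsub>?L\<^esub> ?S)" .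
    moreover have "\<Squnion>\<^bsub>?L\<^esub> ?S \<in> car A" by (intro L.sup_closed) auto
    ultimately show "\<exists>c\<in>car A. \<Union>K = ?E c" by blast
  qed
  then show ?thesis unfolding pt_space_def by (simp add: topology_inverse')
qed

lemma topspace_pt:
  assumes A: "A \<in> ob"
  shows "topspace (pt_space P A) = hom A two"
proof -
  interpret L: complete_lattice "OMap (Ofun P) A"
    using frame_O[OF A] unfolding is_frame_def by blast
  have "hom A two = {f \<in> hom A two. val A f \<top>\<^bsub>OMap (Ofun P) A\<^esub>}"
    using val_top[OF A] by blast
  then have "openin (pt_space P A) (hom A two)"
    unfolding openin_pt[OF A] using L.top_closed by blast
  moreover have "topspace (pt_space P A) \<subseteq> hom A two"
    using openin_topspace[of "pt_space P A"] unfolding openin_pt[OF A] by blast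
  ultimately show ?thesis using openin_subset by blast
qed

lemma TopC_simps [simp]:
  "Obj (TopC P) = {X. in_TopC P X}" "Hom (TopC P) = cont"
  "Id (TopC P) X = (\<lambda>x\<in>topspace X. x)" "Comp (TopC P) X Y Z g f = compose (topspace X) g f"
  unfolding TopC_def full_subcategory_def Top_def by simp_all

lemma op_simps [simp]:
  "Obj (op_category (TopC P)) = {X. in_TopC P X}"
  "Hom (op_category (TopC P)) X Y = cont Y X"
  "Id (op_category (TopC P)) X = (\<lambda>x\<in>topspace X. x)"
  "Comp (op_category (TopC P)) X Y Z g f = compose (topspace Z) f g"
  unfolding op_category_def by simp_all

text \<open>The open sets of \<open>pt A\<close>, as continuous maps to the Sierpinski space.\<close>

lemma cont_pt_sierpinski:
  assumes A: "A \<in> ob"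
  shows "g \<in> cont (pt_space P A) sierpinski \<longleftrightarrow> (\<exists>a\<in>car A. g = (\<lambda>f\<in>hom A two. val A f a))"
proof
  assume g: "g \<in> cont (pt_space P A) sierpinski"
  then obtain a where a: "a \<in> car A" and eq: "{f \<in> hom A two. g f} = {f \<in> hom A two. val A f a}"
    unfolding cont_def continuous_map_sierpinski openin_pt[OF A] topspace_pt[OF A] by auto
  have "g = (\<lambda>f\<in>hom A two. val A f a)"
  proof (rule extensionalityI)
    show "g \<in> extensional (hom A two)"
      using g unfolding cont_def topspace_pt[OF A] by simp
  qed (use eq in auto)
  with a show "\<exists>a\<in>car A. g = (\<lambda>f\<in>hom A two. val A f a)" by blast
next
  assume "\<exists>a\<in>car A. g = (\<lambda>f\<in>hom A two. val A f a)"
  then show "g \<in> cont (pt_space P A) sierpinski"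
    unfolding cont_def continuous_map_sierpinski openin_pt[OF A] topspace_pt[OF A] by auto
qed

section \<open>Arrows into the chosen lifts\<close>

lemma W_ob: "in_TopC P X \<Longrightarrow> W X \<in> ob"
  and bij_theta: "in_TopC P X \<Longrightarrow> bij_betw (\<theta> X) (car (W X)) (cont X sierpinski)"
  using chosen unfolding chosen_lifts_def chi_cartesian_lift_def cartesian_lift_def by auto

lemma theta_in: "\<lbrakk>in_TopC P X; a \<in> car (W X)\<rbrakk> \<Longrightarrow> \<theta> X a \<in> cont X sierpinski"
  using bij_theta bij_betwE by blast

lemma lifts_iff:
  assumes "in_TopC P X" "D \<in> ob" "h \<in> car D \<rightarrow>\<^sub>E car (W X)"
  shows "lifts (Cat P) (UO P) D (W X) h \<longleftrightarrow>
    (\<forall>x\<in>topspace X. lifts (Cat P) (UO P) D two (\<lambda>a\<in>car D. iota_inv P (\<theta> X (h a) x)))"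
  using chosen assms
  unfolding chosen_lifts_def chi_cartesian_lift_def cartesian_lift_def chi_def by simp

lemma theta_eqI:
  assumes "in_TopC P X" "a \<in> car (W X)" "b \<in> car (W X)"
    and "\<And>x. x \<in> topspace X \<Longrightarrow> \<theta> X a x = \<theta> X b x"
  shows "a = b"
proof -
  have "\<theta> X a = \<theta> X b"
    using theta_in[OF assms(1)] assms(2-4) unfolding cont_def
    by (intro extensionalityI[where A = "topspace X"]) auto
  then show ?thesis
    using bij_theta[OF assms(1)] assms(2,3) by (auto simp: bij_betw_def inj_on_def)
qed

lemma theta_inv:
  assumes "in_TopC P X" "g \<in> cont X sierpinski"
  shows "theta_inv P W \<theta> X g \<in> car (W X)" "\<theta> X (theta_inv P W \<theta> X g) = g"
proof -
  have "g \<in> \<theta> X ` car (W X)"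
    using bij_theta[OF assms(1)] assms(2) by (simp add: bij_betw_def)
  then show "theta_inv P W \<theta> X g \<in> car (W X)" "\<theta> X (theta_inv P W \<theta> X g) = g"
    unfolding theta_inv_def UO_simps by (rule inv_into_into, rule f_inv_into_f)
qed

lemma arrow_into_W_eqI:
  assumes "in_TopC P X" "A \<in> ob" "p \<in> hom A (W X)" "q \<in> hom A (W X)"
    and "\<And>a x. \<lbrakk>a \<in> car A; x \<in> topspace X\<rbrakk> \<Longrightarrow> \<theta> X (arr A (W X) p a) x = \<theta> X (arr A (W X) q a) x"
  shows "p = q"
proof (rule arr_eqI[OF assms(2) W_ob[OF assms(1)] assms(3,4)])
  fix a assume a: "a \<in> car A"
  note arr_in' = arr_in[OF assms(2) W_ob[OF assms(1)] _ a]
  show "arr A (W X) p a = arr A (W X) q a"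
    by (rule theta_eqI[OF assms(1) arr_in'[OF assms(3)] arr_in'[OF assms(4)] assms(5)[OF a]])
qed

text \<open>
  The existence half of cartesianness: a function into \<open>|\<Omega> X|\<close> underlies an arrow as soon as its
  truth values at each point of \<open>X\<close> are those of an arrow into \<open>2\<^sub>C\<close>.
\<close>

lemma arrow_into_W_exists:
  assumes X: "in_TopC P X" and D: "D \<in> ob" and h: "h \<in> car D \<rightarrow>\<^sub>E car (W X)"
    and points: "\<And>x. x \<in> topspace X \<Longrightarrow> \<exists>p\<in>hom D two. \<forall>a\<in>car D. val D p a = \<theta> X (h a) x"
  shows "\<exists>p\<in>hom D (W X). arr D (W X) p = h"
proof -
  have "lifts (Cat P) (UO P) D two (\<lambda>a\<in>car D. iota_inv P (\<theta> X (h a) x))"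
    if x: "x \<in> topspace X" for x
  proof -
    obtain p where p: "p \<in> hom D two" and val: "\<forall>a\<in>car D. val D p a = \<theta> X (h a) x"
      using points[OF x] by blast
    have "arr D two p = (\<lambda>a\<in>car D. iota_inv P (\<theta> X (h a) x))"
    proof (rule extensionalityI)
      show "arr D two p \<in> extensional (car D)" using arr_PiE[OF D two p] by (simp add: PiE_def)
      fix a assume a: "a \<in> car D"
      then show "arr D two p a = (\<lambda>a\<in>car D. iota_inv P (\<theta> X (h a) x)) a"
        using val iota_inv_iota[OF arr_in[OF D two p a]] by simp
    qed simp
    then show ?thesis unfolding lifts_def using p by auto
  qed
  then have "lifts (Cat P) (UO P) D (W X) h" using lifts_iff[OF X D h] by blast
  then show ?thesis unfolding lifts_def by auto
qed

lemma chi_bar: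
  assumes X: "in_TopC P X" and x: "x \<in> topspace X"
  shows "chi_bar P W \<theta> X x \<in> hom (W X) two"
    and "a \<in> car (W X) \<Longrightarrow> val (W X) (chi_bar P W \<theta> X x) a = \<theta> X a x"
proof -
  note WX = W_ob[OF X]
  let ?i = "\<lambda>a\<in>car (W X). a"
  \<comment> \<open>The identity lifts, so its composites with all evaluations do.\<close>
  have "arr (W X) (W X) (Id (Cat P) (W X)) = ?i"
    using fun_O WX unfolding is_functor_def Frm_def by simp
  then have "lifts (Cat P) (UO P) (W X) (W X) ?i"
    unfolding lifts_def using id_hom[OF WX] by auto
  moreover have "?i \<in> car (W X) \<rightarrow>\<^sub>E car (W X)" by auto
  ultimately have "lifts (Cat P) (UO P) (W X) two (\<lambda>a\<in>car (W X). iota_inv P (\<theta> X (?i a) x))"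
    using lifts_iff[OF X WX] x by blast
  moreover have "(\<lambda>a\<in>car (W X). iota_inv P (\<theta> X (?i a) x)) =
      (\<lambda>a\<in>car (W X). iota_inv P (chi x (\<theta> X a)))"
    by (auto simp: chi_def fun_eq_iff)
  ultimately obtain p where p: "p \<in> hom (W X) two"
    and arr_p: "arr (W X) two p = (\<lambda>a\<in>car (W X). iota_inv P (chi x (\<theta> X a)))"
    unfolding lifts_def by auto
  have eq: "chi_bar P W \<theta> X x = p"
    unfolding chi_bar_def UO_simps by (rule lift_of_eq[OF WX two p arr_p])
  show "chi_bar P W \<theta> X x \<in> hom (W X) two" using p eq by simp
  show "val (W X) (chi_bar P W \<theta> X x) a = \<theta> X a x" if "a \<in> car (W X)"
    using that unfolding eq arr_p by (simp add: iota_iota_inv chi_def)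
qed

section \<open>The two functors\<close>

text \<open>For a continuous map \<open>f : X \<rightarrow> Y\<close>, the arrow \<open>\<Omega> f : \<Omega> Y \<rightarrow> \<Omega> X\<close> is \<open>Om Y X f\<close>; for an arrow
  \<open>f : A \<rightarrow> B\<close>, the continuous map \<open>pt f : pt B \<rightarrow> pt A\<close> is \<open>pt A B f\<close>.\<close>

abbreviation "Om Y X f \<equiv> AMap (Omega_functor P W \<theta>) Y X f"
abbreviation "pt A B f \<equiv> AMap (pt_functor P) A B f"

lemma Omega:
  assumes X: "in_TopC P X" and Y: "in_TopC P Y" and f: "f \<in> cont X Y"
  shows "Om Y X f \<in> hom (W Y) (W X)"
    and "\<lbrakk>a \<in> car (W Y); x \<in> topspace X\<rbrakk> \<Longrightarrow> \<theta> X (arr (W Y) (W X) (Om Y X f) a) x = \<theta> Y a (f x)"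
proof -
  let ?h = "\<lambda>a\<in>car (W Y). theta_inv P W \<theta> X (compose (topspace X) (\<theta> Y a) f)"
  have h: "?h a \<in> car (W X) \<and> \<theta> X (?h a) = compose (topspace X) (\<theta> Y a) f"
    if "a \<in> car (W Y)" for a
    using theta_inv[OF X cont_comp[OF f theta_in[OF Y that]]] that by simp
  have "\<exists>p\<in>hom (W Y) (W X). arr (W Y) (W X) p = ?h"
  proof (rule arrow_into_W_exists[OF X W_ob[OF Y]])
    show "?h \<in> car (W Y) \<rightarrow>\<^sub>E car (W X)" using h by auto
    fix x assume x: "x \<in> topspace X"
    have "\<forall>a\<in>car (W Y). val (W Y) (chi_bar P W \<theta> Y (f x)) a = \<theta> X (?h a) x"
      using chi_bar(2)[OF Y cont_in[OF f x]] h x by (simp add: compose_eq)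
    then show "\<exists>p\<in>hom (W Y) two. \<forall>a\<in>car (W Y). val (W Y) p a = \<theta> X (?h a) x"
      using chi_bar(1)[OF Y cont_in[OF f x]] by blast
  qed
  then obtain p where p: "p \<in> hom (W Y) (W X)" and arr_p: "arr (W Y) (W X) p = ?h" by blast
  have eq: "Om Y X f = p"
    unfolding Omega_functor_def using lift_of_eq[OF W_ob[OF Y] W_ob[OF X] p arr_p] by simp
  show "Om Y X f \<in> hom (W Y) (W X)" using p eq by simp
  show "\<theta> X (arr (W Y) (W X) (Om Y X f) a) x = \<theta> Y a (f x)"
    if "a \<in> car (W Y)" "x \<in> topspace X"
    using h[OF that(1)] that(2) unfolding eq arr_p by (simp add: compose_eq)
qed

lemma OMap_Omega [simp]: "OMap (Omega_functor P W \<theta>) = W"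
  unfolding Omega_functor_def by simp

lemma OMap_pt [simp]: "OMap (pt_functor P) = pt_space P"
  unfolding pt_functor_def by simp

lemma is_functor_Omega: "is_functor (op_category (TopC P)) (Cat P) (Omega_functor P W \<theta>)"
proof -
  have ident: "Om X X (\<lambda>x\<in>topspace X. x) = Id (Cat P) (W X)" if X: "in_TopC P X" for X
    using Omega[OF X X cont_id] id_hom[OF W_ob[OF X]] arr_id[OF W_ob[OF X]]
    by (intro arrow_into_W_eqI[OF X W_ob[OF X]]) auto
  have "Om X Z (compose (topspace Z) f g) = cmp (W X) (W Y) (W Z) (Om Y Z g) (Om X Y f)"
    if X: "in_TopC P X" and Y: "in_TopC P Y" and Z: "in_TopC P Z"
      and f: "f \<in> cont Y X" and g: "g \<in> cont Z Y" for X Y Z f g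
  proof (rule arrow_into_W_eqI[OF Z W_ob[OF X]])
    note gf = Omega[OF Z X cont_comp[OF g f]] and f' = Omega[OF Y X f] and g' = Omega[OF Z Y g]
    show "Om X Z (compose (topspace Z) f g) \<in> hom (W X) (W Z)" by (rule gf(1))
    show "cmp (W X) (W Y) (W Z) (Om Y Z g) (Om X Y f) \<in> hom (W X) (W Z)"
      using cmp_hom W_ob X Y Z f' g' by blast
    fix a z assume a: "a \<in> car (W X)" and z: "z \<in> topspace Z"
    show "\<theta> Z (arr (W X) (W Z) (Om X Z (compose (topspace Z) f g)) a) z =
        \<theta> Z (arr (W X) (W Z) (cmp (W X) (W Y) (W Z) (Om Y Z g) (Om X Y f)) a) z"
      using a z gf(2) f' g' cont_in[OF g z] arr_in[OF W_ob[OF X] W_ob[OF Y] f'(1) a]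
        arr_cmp[OF W_ob[OF X] W_ob[OF Y] W_ob[OF Z] f'(1) g'(1) a]
      by (simp add: compose_eq)
  qed
  then show ?thesis
    unfolding is_functor_def using ident Omega W_ob by auto
qed

lemma pt_apply: "g \<in> hom B two \<Longrightarrow> pt A B f g = cmp A B two g f"
  unfolding pt_functor_def by simp

lemma pt_cont:
  assumes A: "A \<in> ob" and B: "B \<in> ob" and f: "f \<in> hom A B"
  shows "pt A B f \<in> cont (pt_space P B) (pt_space P A)"
proof -
  have in_hom: "pt A B f g \<in> hom A two" if "g \<in> hom B two" for g
    using cmp_hom[OF A B two f that] pt_apply[OF that] by simp
  have "openin (pt_space P B) {g \<in> hom B two. pt A B f g \<in> U}"
    if "openin (pt_space P A) U" for U
  proof -
    obtain a where a: "a \<in> car A" and U: "U = {g \<in> hom A two. val A g a}"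
      using \<open>openin (pt_space P A) U\<close> unfolding openin_pt[OF A] by blast
    have "{g \<in> hom B two. pt A B f g \<in> U} = {g \<in> hom B two. val B g (arr A B f a)}"
      unfolding U using in_hom arr_cmp[OF A B two f _ a] pt_apply by auto
    then show ?thesis unfolding openin_pt[OF B] using arr_in[OF A B f a] by blast
  qed
  then have "continuous_map (pt_space P B) (pt_space P A) (pt A B f)"
    unfolding continuous_map_def topspace_pt[OF A] topspace_pt[OF B] using in_hom by auto
  then show ?thesis
    unfolding cont_def topspace_pt[OF B] by (simp add: pt_functor_def)
qed

lemma is_functor_pt: "is_functor (Cat P) (op_category (TopC P)) (pt_functor P)"
proof -
  have "pt A A (Id (Cat P) A) = (\<lambda>g\<in>hom A two. g)" if "A \<in> ob" for A
    using cmp_id[OF that two] by (auto simp: pt_functor_def fun_eq_iff)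
  moreover have "pt A D (cmp A B D g f) = compose (hom D two) (pt A B f) (pt B D g)"
    if "A \<in> ob" "B \<in> ob" "D \<in> ob" "f \<in> hom A B" "g \<in> hom B D" for A B D f g
    using cmp_assoc[OF that(1-3) two that(4,5)] cmp_hom[OF that(2,3) two that(5)]
    by (auto simp: pt_functor_def fun_eq_iff compose_def)
  ultimately show ?thesis
    unfolding is_functor_def using pt_cont pt_in_TopC by (simp add: topspace_pt)
qed

section \<open>Unit and counit\<close>

abbreviation "\<eta> \<equiv> eta P W \<theta>"
abbreviation "\<sigma> \<equiv> sigma P W \<theta>"

lemma W_pt_ob: "A \<in> ob \<Longrightarrow> W (pt_space P A) \<in> ob"
  using W_ob pt_in_TopC by blast

lemma eta:
  assumes A: "A \<in> ob"
  shows "\<eta> A \<in> hom A (W (pt_space P A))"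
    and "\<lbrakk>a \<in> car A; f \<in> hom A two\<rbrakk> \<Longrightarrow>
      \<theta> (pt_space P A) (arr A (W (pt_space P A)) (\<eta> A) a) f = val A f a"
proof -
  let ?X = "pt_space P A"
  let ?v = "\<lambda>a. \<lambda>f\<in>hom A two. val A f a"
  let ?h = "\<lambda>a\<in>car A. theta_inv P W \<theta> ?X (?v a)"
  note X = pt_in_TopC[OF A]
  have h: "?h a \<in> car (W ?X) \<and> \<theta> ?X (?h a) = ?v a" if "a \<in> car A" for a
  proof -
    have "?v a \<in> cont ?X sierpinski" unfolding cont_pt_sierpinski[OF A] using that by blast
    then show ?thesis using theta_inv[OF X] that by simp
  qed
  have "\<exists>p\<in>hom A (W ?X). arr A (W ?X) p = ?h"
  proof (rule arrow_into_W_exists[OF X A])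
    show "?h \<in> car A \<rightarrow>\<^sub>E car (W ?X)" using h by auto
    fix f assume "f \<in> topspace ?X"
    then have f: "f \<in> hom A two" using topspace_pt[OF A] by simp
    then have "\<forall>a\<in>car A. val A f a = \<theta> ?X (?h a) f" using h by simp
    with f show "\<exists>p\<in>hom A two. \<forall>a\<in>car A. val A p a = \<theta> ?X (?h a) f" by blast
  qed
  then obtain p where p: "p \<in> hom A (W ?X)" and arr_p: "arr A (W ?X) p = ?h" by blast
  have v: "\<forall>a\<in>car A. \<theta> ?X (arr A (W ?X) p a) = ?v a" using arr_p h by simp
  have eq: "\<eta> A = p"
    unfolding eta_def UO_simps
  proof (rule the_equality)
    fix q assume q: "q \<in> hom A (W ?X) \<and> (\<forall>a\<in>car A. \<theta> ?X (arr A (W ?X) q a) = ?v a)"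
    then show "q = p" using v p by (intro arrow_into_W_eqI[OF X A]) auto
  qed (use p v in blast)
  show "\<eta> A \<in> hom A (W ?X)" using p eq by simp
  show "\<theta> ?X (arr A (W ?X) (\<eta> A) a) f = val A f a" if "a \<in> car A" "f \<in> hom A two"
    using that v eq by simp
qed

lemma sigma_apply: "x \<in> topspace X \<Longrightarrow> \<sigma> X x = chi_bar P W \<theta> X x"
  unfolding sigma_def by simp

lemma sigma_cont:
  assumes X: "in_TopC P X"
  shows "\<sigma> X \<in> cont X (pt_space P (W X))"
proof -
  note WX = W_ob[OF X]
  have "openin X {x \<in> topspace X. \<sigma> X x \<in> U}" if "openin (pt_space P (W X)) U" for U
  proof -
    obtain a where a: "a \<in> car (W X)" and U: "U = {f \<in> hom (W X) two. val (W X) f a}"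
      using \<open>openin (pt_space P (W X)) U\<close> unfolding openin_pt[OF WX] by blast
    have "{x \<in> topspace X. \<sigma> X x \<in> U} = {x \<in> topspace X. \<theta> X a x}"
      unfolding U using chi_bar[OF X] a sigma_apply by auto
    then show ?thesis
      using theta_in[OF X a] unfolding cont_def continuous_map_sierpinski by simp
  qed
  then have "continuous_map X (pt_space P (W X)) (\<sigma> X)"
    unfolding continuous_map_def topspace_pt[OF WX] using chi_bar(1)[OF X] sigma_apply by auto
  then show ?thesis unfolding cont_def sigma_def by simp
qed

lemma nat_trans_eta:
  "nat_trans (Cat P) (Cat P) id_functor (comp_functor (Omega_functor P W \<theta>) (pt_functor P)) \<eta>"
proof -
  have "cmp A B (W (pt_space P B)) (\<eta> B) f =
      cmp A (W (pt_space P A)) (W (pt_space P B))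
        (Om (pt_space P A) (pt_space P B) (pt A B f)) (\<eta> A)"
    if A: "A \<in> ob" and B: "B \<in> ob" and f: "f \<in> hom A B" for A B f
  proof (rule arrow_into_W_eqI[OF pt_in_TopC[OF B] A])
    let ?WA = "W (pt_space P A)" and ?WB = "W (pt_space P B)"
    let ?Of = "Om (pt_space P A) (pt_space P B) (pt A B f)"
    note WA = W_pt_ob[OF A] and WB = W_pt_ob[OF B]
    note Of = Omega[OF pt_in_TopC[OF B] pt_in_TopC[OF A] pt_cont[OF A B f]]
    show "cmp A B ?WB (\<eta> B) f \<in> hom A ?WB" by (rule cmp_hom[OF A B WB f eta(1)[OF B]])
    show "cmp A ?WA ?WB ?Of (\<eta> A) \<in> hom A ?WB"
      by (rule cmp_hom[OF A WA WB eta(1)[OF A] Of(1)])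
    fix a g assume a: "a \<in> car A" and "g \<in> topspace (pt_space P B)"
    then have g: "g \<in> hom B two" "g \<in> topspace (pt_space P B)" using topspace_pt[OF B] by auto
    have "\<theta> (pt_space P B) (arr A ?WB (cmp A B ?WB (\<eta> B) f) a) g = val B g (arr A B f a)"
      using arr_cmp[OF A B WB f eta(1)[OF B] a] eta(2)[OF B arr_in[OF A B f a] g(1)] by simp
    also have "\<dots> = val A (pt A B f g) a"
      using pt_apply[OF g(1)] arr_cmp[OF A B two f g(1) a] by simp
    also have "\<dots> = \<theta> (pt_space P A) (arr A ?WA (\<eta> A) a) (pt A B f g)"
      using eta(2)[OF A a] pt_apply[OF g(1)] cmp_hom[OF A B two f g(1)] by simp
    also have "\<dots> = \<theta> (pt_space P B) (arr A ?WB (cmp A ?WA ?WB ?Of (\<eta> A)) a) g"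
      using arr_cmp[OF A WA WB eta(1)[OF A] Of(1) a] Of(2)[OF arr_in[OF A WA eta(1)[OF A] a] g(2)]
      by simp
    finally show "\<theta> (pt_space P B) (arr A ?WB (cmp A B ?WB (\<eta> B) f) a) g =
        \<theta> (pt_space P B) (arr A ?WB (cmp A ?WA ?WB ?Of (\<eta> A)) a) g" .
  qed
  then show ?thesis
    unfolding nat_trans_def id_functor_def comp_functor_def using eta(1) by simp
qed

lemma nat_trans_sigma:
  "nat_trans (op_category (TopC P)) (op_category (TopC P))
     (comp_functor (pt_functor P) (Omega_functor P W \<theta>)) id_functor \<sigma>"
proof -
  have "compose (topspace X) (pt (W Y) (W X) (Om Y X f)) (\<sigma> X) = compose (topspace X) (\<sigma> Y) f"
    if X: "in_TopC P X" and Y: "in_TopC P Y" and f: "f \<in> cont X Y" for X Y f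
  proof (rule extensionalityI[OF compose_extensional compose_extensional])
    fix x assume x: "x \<in> topspace X"
    note WX = W_ob[OF X] and WY = W_ob[OF Y] and cx = chi_bar[OF X x]
      and cfx = chi_bar[OF Y cont_in[OF f x]] and Of = Omega[OF X Y f]
    have "cmp (W Y) (W X) two (chi_bar P W \<theta> X x) (Om Y X f) = chi_bar P W \<theta> Y (f x)"
    proof (rule point_eqI[OF WY cmp_hom[OF WY WX two Of(1) cx(1)] cfx(1)])
      fix a assume a: "a \<in> car (W Y)"
      show "val (W Y) (cmp (W Y) (W X) two (chi_bar P W \<theta> X x) (Om Y X f)) a =
          val (W Y) (chi_bar P W \<theta> Y (f x)) a"
        using arr_cmp[OF WY WX two Of(1) cx(1) a] cx(2)[OF arr_in[OF WY WX Of(1) a]]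
          Of(2)[OF a x] cfx(2)[OF a] by simp
    qed
    then show "compose (topspace X) (pt (W Y) (W X) (Om Y X f)) (\<sigma> X) x =
        compose (topspace X) (\<sigma> Y) f x"
      using x sigma_apply cont_in[OF f x] pt_apply[OF cx(1)] by (simp add: compose_eq)
  qed
  then show ?thesis
    unfolding nat_trans_def id_functor_def comp_functor_def using sigma_cont by simp
qed

lemma triangle_pt:
  assumes A: "A \<in> ob"
  shows "compose (hom A two) (pt A (W (pt_space P A)) (\<eta> A)) (\<sigma> (pt_space P A)) = (\<lambda>f\<in>hom A two. f)"
proof (rule extensionalityI[OF compose_extensional])
  fix f assume f: "f \<in> hom A two"
  let ?X = "pt_space P A"
  have fX: "f \<in> topspace ?X" using f topspace_pt[OF A] by simp
  note WX = W_pt_ob[OF A] and cf = chi_bar[OF pt_in_TopC[OF A] fX]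
  have "cmp A (W ?X) two (chi_bar P W \<theta> ?X f) (\<eta> A) = f"
  proof (rule point_eqI[OF A cmp_hom[OF A WX two eta(1)[OF A] cf(1)] f])
    fix a assume a: "a \<in> car A"
    show "val A (cmp A (W ?X) two (chi_bar P W \<theta> ?X f) (\<eta> A)) a = val A f a"
      using arr_cmp[OF A WX two eta(1)[OF A] cf(1) a] cf(2)[OF arr_in[OF A WX eta(1)[OF A] a]]
        eta(2)[OF A a f] by simp
  qed
  then show "compose (hom A two) (pt A (W ?X) (\<eta> A)) (\<sigma> ?X) f = (\<lambda>f\<in>hom A two. f) f"
    using f sigma_apply[OF fX] pt_apply[OF cf(1)] by (simp add: compose_eq)
qed simp

lemma triangle_Omega:
  assumes X: "in_TopC P X"
  defines "Z \<equiv> pt_space P (W X)"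
  shows "cmp (W X) (W Z) (W X) (Om Z X (\<sigma> X)) (\<eta> (W X)) = Id (Cat P) (W X)"
proof -
  note WX = W_ob[OF X]
  note Z = pt_in_TopC[OF WX, folded Z_def] and eta = eta[OF WX, folded Z_def]
  note WZ = W_ob[OF Z] and Os = Omega[OF X Z sigma_cont[OF X, folded Z_def]]
  show ?thesis
  proof (rule arrow_into_W_eqI[OF X WX cmp_hom[OF WX WZ WX eta(1) Os(1)] id_hom[OF WX]])
    fix a x assume a: "a \<in> car (W X)" and x: "x \<in> topspace X"
    show "\<theta> X (arr (W X) (W X) (cmp (W X) (W Z) (W X) (Om Z X (\<sigma> X)) (\<eta> (W X))) a) x =
        \<theta> X (arr (W X) (W X) (Id (Cat P) (W X)) a) x"
      using arr_cmp[OF WX WZ WX eta(1) Os(1) a] Os(2)[OF arr_in[OF WX WZ eta(1) a] x]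
        sigma_apply[OF x] eta(2)[OF a chi_bar(1)[OF X x]] chi_bar(2)[OF X x a] arr_id[OF WX a]
      by simp
  qed
qed

lemma adjunction_pt_Omega:
  "adjunction (Cat P) (op_category (TopC P)) (pt_functor P) (Omega_functor P W \<theta>) \<eta> \<sigma>"
proof -
  have "is_category (op_category (TopC P))"
    unfolding TopC_def by (intro is_category_op is_category_full_subcategory is_category_Top)
  then show ?thesis
    unfolding adjunction_def
    using cat is_functor_pt is_functor_Omega nat_trans_eta nat_trans_sigma
      triangle_pt triangle_Omega by (simp add: topspace_pt)
qed

section \<open>Idempotency\<close>

text \<open>
  Every open set of \<open>pt A\<close> comes from an element of \<open>|A|\<close>, by definition of the topology.
\<close>

lemma eta_surj:
  assumes A: "A \<in> ob" and b: "b \<in> car (W (pt_space P A))"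
  shows "\<exists>a\<in>car A. arr A (W (pt_space P A)) (\<eta> A) a = b"
proof -
  note X = pt_in_TopC[OF A]
  obtain a where a: "a \<in> car A" and v: "\<theta> (pt_space P A) b = (\<lambda>f\<in>hom A two. val A f a)"
    using theta_in[OF X b] unfolding cont_pt_sierpinski[OF A] by blast
  have "arr A (W (pt_space P A)) (\<eta> A) a = b"
    using a b v eta[OF A] arr_in[OF A W_ob[OF X]]
    by (intro theta_eqI[OF X]) (auto simp: topspace_pt[OF A])
  with a show ?thesis by blast
qed

lemma iso_eta_Omega:
  assumes X: "in_TopC P X"
  shows "iso_arrow (Cat P) (W X) (W (pt_space P (W X))) (\<eta> (W X))"
proof -
  define Z where "Z = pt_space P (W X)"
  note WX = W_ob[OF X]
  note Z = pt_in_TopC[OF WX, folded Z_def] and e = eta(1)[OF WX, folded Z_def]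
  note WZ = W_ob[OF Z] and s = Omega(1)[OF X Z sigma_cont[OF X, folded Z_def]]
  note left_inv = triangle_Omega[OF X, folded Z_def]
  have "cmp (W Z) (W X) (W Z) (\<eta> (W X)) (Om Z X (\<sigma> X)) = Id (Cat P) (W Z)"
  proof (rule arr_eqI[OF WZ WZ cmp_hom[OF WZ WX WZ s e] id_hom[OF WZ]])
    fix b assume b: "b \<in> car (W Z)"
    \<comment> \<open>A left inverse of a surjective function is a right inverse as well.\<close>
    obtain a where a: "a \<in> car (W X)" and ab: "arr (W X) (W Z) (\<eta> (W X)) a = b"
      using eta_surj[OF WX, folded Z_def, OF b] by blast
    have "arr (W Z) (W X) (Om Z X (\<sigma> X)) b = a"
      using arr_cmp[OF WX WZ WX e s a] arr_id[OF WX a] left_inv ab by simp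
    then show "arr (W Z) (W Z) (cmp (W Z) (W X) (W Z) (\<eta> (W X)) (Om Z X (\<sigma> X))) b =
        arr (W Z) (W Z) (Id (Cat P) (W Z)) b"
      using arr_cmp[OF WZ WX WZ s e b] arr_id[OF WZ b] ab by simp
  qed
  then show ?thesis
    unfolding iso_arrow_def Z_def[symmetric] using e s left_inv by blast
qed

end

theorem theorem2p6:
  fixes P :: "('o, 'u, 'a) pfc"
    and W :: "'u topology \<Rightarrow> 'o"
    and \<theta> :: "'u topology \<Rightarrow> 'a \<Rightarrow> 'u \<Rightarrow> bool"
  assumes "sfc_category P"
    and "chosen_lifts P W \<theta>"
  shows "idempotent_adjunction (Cat P) (op_category (TopC P))
           (pt_functor P) (Omega_functor P W \<theta>) (eta P W \<theta>) (sigma P W \<theta>)"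
proof -
  interpret pfc_with_lifts P W \<theta>
    using assms unfolding sfc_category_def by unfold_locales auto
  show ?thesis
    unfolding idempotent_adjunction_def using adjunction_pt_Omega iso_eta_Omega by simp
qed

end
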